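(* Let $r\geq2$ and $1\leq i\leq r$ be integers, let $\lambda$ be a partition and $x_\lambda$ its associated monomial. Then $x_\lambda\notin I_{r,i}$ (i.e. $x_\lambda$ is a monomial of $\mathbf{K}[x_1,x_2,\dots]/I_{r,i}$) if and only if $\lambda\in\mathcal{D}_{r,i}$. Equivalently, $\mathcal{C}_{r,i}=\mathcal{D}_{r,i}$.
   Context: $\mathbf{K}$ is a field of characteristic $0$ and $\mathbf{K}[x_1,x_2,\dots]$ the polynomial ring in countably many variables, $x_j$ of weight $j$. To a partition $\lambda=(\lambda_1,\dots,\lambda_s)$ (non-increasing sequence of positive integers) is associated the monomial $x_\lambda=x_{\lambda_1}\cdots x_{\lambda_s}$. The ideal $I_{r,i}$ is generated by $x_1^i$ and all monomials $x_{n_{1,1}}\,(x_{n_{2,1}}\cdots x_{n_{2,f(2)}})\,(x_{n_{3,1}}\cdots x_{n_{3,f(3)}})\cdots(x_{n_{r,1}}\cdots x_{n_{r,f(r)}})$ (the $j$-th parenthesized group is the $j$-th block) where the positive integers satisfy $n_{1,1}\le n_{2,1}\le\dots\le n_{2,f(2)}\le n_{3,1}\le\dots\le n_{r,f(r)}$ and $f(1)=1$, $f(j)=n_{j-1,f(j-1)}$ for $2\le j\le i$, $f(j)=n_{j-1,f(j-1)}-1$ for $i+1\le j\le r$ (if some $f(j)=0$, block $j$ and all later blocks are empty). For $\lambda=(\lambda_1,\dots,\lambda_s)$ with $\lambda_j:=0$ for $j\le0$, define for $1\le\ell\le r-1$: $p_{i,1}(\lambda)=\lambda_s$; $p_{i,\ell}(\lambda)=\lambda_{s-\sum_{j<\ell}p_{i,j}(\lambda)}$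 if $2\le\ell\le i$; $p_{i,\ell}(\lambda)=\lambda_{s+\ell-i-\sum_{j<\ell}p_{i,j}(\lambda)}$ if $i<\ell\le r-1$; if $p_{i,\ell}(\lambda)=0$ then $p_{i,j}(\lambda)=0$ for $j>\ell$. $N_{r,i}(\lambda)$ is the number of nonzero $p_{i,\ell}(\lambda)$. $\mathcal{C}_{r,i}$ is the set of partitions with at most $i-1$ parts equal to $1$ and with either $N_{r,i}(\lambda)<r-1$, or $N_{r,i}(\lambda)=r-1$ and $s\le\sum_{j=1}^{r-1}p_{i,j}(\lambda)-(r-i)$. For a partition $\mu=(\mu_1,\dots,\mu_t)$ let $\mathrm{sq}(\mu)=\max\{d\ge0:d\le t,\ \mu_d\ge d\}$ and $\mathrm{rect}(\mu)=\max\{h\ge0:h\le t,\ \mu_h\ge h+1\}$. $\mathcal{D}_{r,i}$ is the set of partitions $\lambda$ such that, with $\mu^{(0)}=\lambda$ and $\mu^{(j)}$ equal to $\mu^{(j-1)}$ with its first $c_j$ parts deleted, where $c_j=\mathrm{rect}(\mu^{(j-1)})$ for $j\le r-i$ and $c_j=\mathrm{sq}(\mu^{(j-1)})$ for $j>r-i$, the partition $\mu^{(r-1)}$ is empty. *)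

theory Defs
  imports Complex_Main "HOL-Library.Poly_Mapping"
begin

text \<open>
  The ring \<open>K[x\<^sub>1, x\<^sub>2, \<dots>]\<close>. Exponent vectors are finitely supported functions on \<open>nat\<close>, where
  position \<open>j\<close> holds the exponent of \<open>x\<^bsub>j+1\<^esub>\<close>, so that there is no spurious variable
  \<open>x\<^sub>0\<close>; accordingly \<open>xvar j\<close> is meaningful for \<open>j \<ge> 1\<close> only.
\<close>

type_synonym 'k xpoly = "(nat \<Rightarrow>\<^sub>0 nat) \<Rightarrow>\<^sub>0 'k"

definition xvar :: "nat \<Rightarrow> 'k::comm_ring_1 xpoly" where
  "xvar j = Poly_Mapping.single (Poly_Mapping.single (j - 1) 1) 1"

definition xmonom :: "nat list \<Rightarrow> 'k::comm_ring_1 xpoly" where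
  "xmonom js = prod_list (map xvar js)"

definition is_partition :: "nat list \<Rightarrow> bool" where
  "is_partition \<mu> \<longleftrightarrow> sorted_wrt (\<ge>) \<mu> \<and> (\<forall>a \<in> set \<mu>. 0 < a)"

text \<open>Parts are numbered from \<open>1\<close>; the index is an integer because of \<open>\<lambda>\<^sub>j = 0\<close> for \<open>j \<le> 0\<close>.\<close>

definition part :: "nat list \<Rightarrow> int \<Rightarrow> nat" where
  "part \<mu> j = (if 1 \<le> j \<and> j \<le> int (length \<mu>) then \<mu> ! nat (j - 1) else 0)"

text \<open>
  The ideal generated by a set is its span in the ring viewed as a module over itself.
\<close>

lemma module_times: "module ((*) :: 'a::comm_ring_1 \<Rightarrow> 'a \<Rightarrow> 'a)"
  by unfold_locales (simp_all add: algebra_simps)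

definition ideal_gen :: "'a::comm_ring_1 set \<Rightarrow> 'a set" where
  "ideal_gen S = module.span (*) S"

text \<open>
  \<open>block_len i n j\<close> is \<open>f(j)\<close> for the array of indices \<open>n j k\<close> (row \<open>j\<close> is the
  \<open>j\<close>-th block); block numbers start at \<open>1\<close>.
\<close>

fun block_len :: "nat \<Rightarrow> (nat \<Rightarrow> nat \<Rightarrow> nat) \<Rightarrow> nat \<Rightarrow> nat" where
  "block_len i n 0 = 0"
| "block_len i n (Suc 0) = 1"
| "block_len i n (Suc (Suc j)) =
    (let f = block_len i n (Suc j)
     in if f = 0 then 0
        else if Suc (Suc j) \<le> i then n (Suc j) f
        else n (Suc j) f - 1)"

definition block_word :: "nat \<Rightarrow> nat \<Rightarrow> (nat \<Rightarrow> nat \<Rightarrow> nat) \<Rightarrow> nat list" where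
  "block_word r i n =
     concat (map (\<lambda>j. map (n j) [1..<block_len i n j + 1]) [1..<r + 1])"

definition I_ideal :: "nat \<Rightarrow> nat \<Rightarrow> 'k::comm_ring_1 xpoly set" where
  "I_ideal r i = ideal_gen
     (insert (xvar 1 ^ i)
       {xmonom (block_word r i n) | n.
          sorted (block_word r i n) \<and> (\<forall>a \<in> set (block_word r i n). 0 < a)})"

text \<open>The value at \<open>l = 0\<close> is a dummy.\<close>

fun p_seq :: "nat \<Rightarrow> nat list \<Rightarrow> nat \<Rightarrow> nat" where
  "p_seq i \<mu> l =
    (if l = 0 then 0
     else if l = 1 then part \<mu> (int (length \<mu>))
     else if p_seq i \<mu> (l - 1) = 0 then 0
     else if l \<le> i then part \<mu> (int (length \<mu>) - (\<Sum>j = 1..<l. int (p_seq i \<mu> j)))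
     else part \<mu> (int (length \<mu>) + int l - int i - (\<Sum>j = 1..<l. int (p_seq i \<mu> j))))"

declare p_seq.simps [simp del]

definition N_num :: "nat \<Rightarrow> nat \<Rightarrow> nat list \<Rightarrow> nat" where
  "N_num r i \<mu> = card {l \<in> {1..r - 1}. p_seq i \<mu> l \<noteq> 0}"

definition C_set :: "nat \<Rightarrow> nat \<Rightarrow> nat list set" where
  "C_set r i = {\<mu>. is_partition \<mu> \<and> count_list \<mu> 1 \<le> i - 1 \<and>
     (N_num r i \<mu> < r - 1 \<or>
      N_num r i \<mu> = r - 1 \<and>
      int (length \<mu>) \<le> (\<Sum>j = 1..r - 1. int (p_seq i \<mu> j)) - (int r - int i))}"

definition sq :: "nat list \<Rightarrow> nat" where
  "sq \<mu> = Max {d. d \<le> length \<mu> \<and> (d = 0 \<or> d \<le> part \<mu> (int d))}"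

definition rect :: "nat list \<Rightarrow> nat" where
  "rect \<mu> = Max {h. h \<le> length \<mu> \<and> (h = 0 \<or> h + 1 \<le> part \<mu> (int h))}"

primrec dissect :: "nat \<Rightarrow> nat \<Rightarrow> nat list \<Rightarrow> nat \<Rightarrow> nat list" where
  "dissect r i \<mu> 0 = \<mu>"
| "dissect r i \<mu> (Suc j) =
    (let \<nu> = dissect r i \<mu> j
     in drop (if Suc j \<le> r - i then rect \<nu> else sq \<nu>) \<nu>)"

definition D_set :: "nat \<Rightarrow> nat \<Rightarrow> nat list set" where
  "D_set r i = {\<mu>. is_partition \<mu> \<and> dissect r i \<mu> (r - 1) = []}"

end

theory Submission
  imports Defs "HOL-Library.Multiset"
begin

text \<open>
  Read the parts of \<open>\<mu>\<close> from the smallest to the largest and cut them greedily into consecutive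
  blocks with the lengths prescribed by the generators of \<open>I_ideal r i\<close>. All three conditions say
  that these \<open>r\<close> blocks do not fit into \<open>\<mu>\<close>. Passing to a sub-multiset only increases the sorted
  entries, hence the block lengths, so if any generator divides the monomial then the greedy one
  does. The numbers \<open>p_seq i \<mu> l\<close> are the last entries of the greedy blocks, which gives \<open>C_set\<close>.
  For \<open>D_set\<close>, the parts below a Durfee square (or rectangle) of height \<open>c\<close> force a next block of
  length at most \<open>c\<close> and those inside it one of length at least \<open>c\<close>; so block \<open>k + 1\<close> ends below the
  \<open>(r - 1 - k)\<close>-th square if and only if block \<open>k + 2\<close> ends below the \<open>(r - 2 - k)\<close>-th one.
\<close>

section \<open>Monomial ideals\<close>

text \<open>Truncated subtraction sends the entries 0 and 1 to the same position, hence the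
  positivity hypotheses further on.\<close>

definition xexp :: "nat list \<Rightarrow> nat \<Rightarrow>\<^sub>0 nat" where
  "xexp js = (\<Sum>j\<leftarrow>js. Poly_Mapping.single (j - 1) 1)"

lemma xmonom_eq_single: "xmonom js = Poly_Mapping.single (xexp js) (1 :: 'k::comm_ring_1)"
proof (induction js)
  case (Cons j js)
  have "xmonom (j # js) = (xvar j :: 'k xpoly) * xmonom js"
    by (simp add: xmonom_def)
  then show ?case
    by (simp add: Cons.IH xvar_def mult_single xexp_def)
qed (simp add: xmonom_def xexp_def)

lemma lookup_xexp:
  assumes "\<forall>a \<in> set js. 0 < a"
  shows "Poly_Mapping.lookup (xexp js) k = count (mset js) (Suc k)"
  using assms
  by (induction js) (auto simp: xexp_def lookup_add lookup_single when_def)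

lemma xmonom_subset:
  assumes "mset js \<subseteq># mset ks"
  obtains q where "xmonom ks = (q :: 'k::comm_ring_1 xpoly) * xmonom js"
proof -
  obtain M where M: "mset ks = M + mset js"
    using assms by (metis subset_mset.diff_add)
  have *: "xmonom us = (prod_mset (image_mset xvar (mset us)) :: 'k xpoly)" for us
    unfolding xmonom_def by (metis mset_map prod_mset_prod_list)
  show thesis
    by (rule that[of "prod_mset (image_mset xvar M)"]) (simp add: * M)
qed

text \<open>The polynomials all of whose monomials are multiples of monomials from \<open>M\<close>
  form a submodule containing the generators, hence the whole ideal. Divisibility is additive in
  exponent vectors.\<close>

lemma monomial_ideal_memD:
  fixes M :: "(nat \<Rightarrow>\<^sub>0 nat) set"
  assumes "(Poly_Mapping.single m 1 :: 'k::comm_ring_1 xpoly) \<in> ideal_gen ((\<lambda>g. Poly_Mapping.single g 1) ` M)"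
  shows "\<exists>g \<in> M. \<exists>d. m = d + g"
proof -
  interpret module "(*) :: 'k xpoly \<Rightarrow> 'k xpoly \<Rightarrow> 'k xpoly"
    by (rule module_times)
  let ?T = "{p :: 'k xpoly. \<forall>m \<in> Poly_Mapping.keys p. \<exists>g \<in> M. \<exists>d. m = d + g}"
  have "subspace ?T"
  proof (rule subspaceI)
    show "0 \<in> ?T" by simp
  next
    fix x y assume "x \<in> ?T" "y \<in> ?T"
    then show "x + y \<in> ?T"
      using Poly_Mapping.keys_add[of x y] by blast
  next
    fix c x assume x: "x \<in> ?T"
    have "\<exists>g \<in> M. \<exists>d. m = d + g" if m: "m \<in> Poly_Mapping.keys (c * x)" for m
    proof -
      obtain u v where "m = u + v" "v \<in> Poly_Mapping.keys x"
        using m Poly_Mapping.keys_mult[of c x] by blast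
      moreover from this x obtain g d where "g \<in> M" "v = d + g" by blast
      ultimately have "m = (u + d) + g" by (simp add: add.assoc)
      with \<open>g \<in> M\<close> show ?thesis by blast
    qed
    then show "c * x \<in> ?T" by blast
  qed
  moreover have "(\<lambda>g. Poly_Mapping.single g 1) ` M \<subseteq> ?T"
  proof clarify
    fix g m
    assume "g \<in> M" "m \<in> Poly_Mapping.keys (Poly_Mapping.single g (1 :: 'k))"
    then have "m = 0 + g" by simp
    with \<open>g \<in> M\<close> show "\<exists>g \<in> M. \<exists>d. m = d + g" by blast
  qed
  ultimately have "Poly_Mapping.single m 1 \<in> ?T"
    using assms span_minimal unfolding ideal_gen_def by blast
  then show ?thesis by simp
qed

lemma xmonom_mem_ideal_iff:
  assumes "\<forall>a \<in> set ks. 0 < a" and "\<And>js. js \<in> J \<Longrightarrow> \<forall>a \<in> set js. 0 < a"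
  shows "(xmonom ks :: 'k::comm_ring_1 xpoly) \<in> ideal_gen (xmonom ` J) \<longleftrightarrow>
    (\<exists>js \<in> J. mset js \<subseteq># mset ks)"
proof
  assume "(xmonom ks :: 'k xpoly) \<in> ideal_gen (xmonom ` J)"
  then have "(Poly_Mapping.single (xexp ks) 1 :: 'k xpoly)
      \<in> ideal_gen ((\<lambda>g. Poly_Mapping.single g 1) ` (xexp ` J))"
    by (simp add: xmonom_eq_single image_image)
  from monomial_ideal_memD[OF this]
  obtain js d where js: "js \<in> J" "xexp ks = d + xexp js" by blast
  have "count (mset js) a \<le> count (mset ks) a" for a
  proof (cases a)
    case 0
    then have "a \<notin> set js" using assms(2) js(1) by auto
    then have "count (mset js) a = 0" by (simp add: count_eq_zero_iff)
    then show ?thesis by linarith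
  next
    case (Suc k)
    have "Poly_Mapping.lookup (xexp ks) k = Poly_Mapping.lookup d k + Poly_Mapping.lookup (xexp js) k"
      by (simp add: js(2) lookup_add)
    then show ?thesis
      by (simp add: Suc lookup_xexp[OF assms(1)] lookup_xexp[OF assms(2)[OF js(1)]])
  qed
  then show "\<exists>js \<in> J. mset js \<subseteq># mset ks"
    using js(1) by (auto simp: subseteq_mset_def)
next
  interpret module "(*) :: 'k xpoly \<Rightarrow> 'k xpoly \<Rightarrow> 'k xpoly"
    by (rule module_times)
  assume "\<exists>js \<in> J. mset js \<subseteq># mset ks"
  then obtain js where js: "js \<in> J" "mset js \<subseteq># mset ks" by blast
  obtain q where "xmonom ks = (q :: 'k xpoly) * xmonom js"
    using xmonom_subset[OF js(2)] .
  then show "(xmonom ks :: 'k xpoly) \<in> ideal_gen (xmonom ` J)"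
    using js(1) by (simp add: ideal_gen_def span_scale span_base)
qed

text \<open>At least \<open>k + 1\<close> entries of \<open>b\<close> are at most
  \<open>b ! k\<close>, and all of them recur in \<open>a\<close>; if \<open>a ! k\<close> were
  larger, at most \<open>k\<close> entries of \<open>a\<close> would be that small.\<close>

lemma sorted_subset_nth_le:
  fixes a b :: "'a::linorder list"
  assumes "sorted a" "sorted b" "mset b \<subseteq># mset a" "k < length b"
  shows "a ! k \<le> b ! k"
proof (rule ccontr)
  assume "\<not> a ! k \<le> b ! k"
  then have less: "b ! k < a ! k" by simp
  have len: "length b \<le> length a"
    using size_mset_mono[OF assms(3)] by simp
  let ?P = "\<lambda>x. x \<le> b ! k"
  have "{..k} \<subseteq> {j. j < length b \<and> ?P (b ! j)}"
    using assms(2,4) by (auto intro: sorted_nth_mono)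
  then have "Suc k \<le> length (filter ?P b)"
    using card_mono[of "{j. j < length b \<and> ?P (b ! j)}" "{..k}"]
    by (simp add: length_filter_conv_card)
  also have "\<dots> \<le> length (filter ?P a)"
    using size_mset_mono[OF multiset_filter_mono[OF assms(3), of ?P]]
    by (simp flip: mset_filter)
  also have "\<dots> \<le> k"
  proof -
    have "j < k" if "j < length a" "a ! j \<le> b ! k" for j
    proof (rule ccontr)
      assume "\<not> j < k"
      then have "a ! k \<le> a ! j" using assms(1) that(1) by (simp add: sorted_nth_mono)
      with less that(2) show False by simp
    qed
    then have "{j. j < length a \<and> ?P (a ! j)} \<subseteq> {..<k}" by blast
    then show ?thesis
      using card_mono[of "{..<k}"] by (fastforce simp: length_filter_conv_card)
  qed
  finally show False by simp
qed

section \<open>The greedy choice of blocks\<close>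

text \<open>Blocks are numbered from 1 but \<open>k\<close> from 0: this is f(k + 2) when block k +
  1 ends in \<open>v\<close>.\<close>

definition next_len :: "nat \<Rightarrow> nat \<Rightarrow> nat \<Rightarrow> nat" where
  "next_len i k v = (if k + 2 \<le> i then v else v - 1)"

text \<open>
  Cut an increasing sequence \<open>a\<close> into consecutive blocks of the lengths prescribed by the
  generators. \<open>greedy_end i a k\<close> is the \<open>0\<close>-based position of the last entry of block \<open>k + 1\<close>;
  it gets stuck at some value \<open>\<ge> length a\<close> when the blocks do not fit.
\<close>

primrec greedy_end :: "nat \<Rightarrow> nat list \<Rightarrow> nat \<Rightarrow> nat" where
  "greedy_end i a 0 = 0"
| "greedy_end i a (Suc k) = greedy_end i a k +
    (if greedy_end i a k < length a then next_len i k (a ! greedy_end i a k) else 0)"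

lemma next_len_mono: "u \<le> v \<Longrightarrow> next_len i k u \<le> next_len i k v"
  by (auto simp: next_len_def)

lemma greedy_end_mono: "k \<le> l \<Longrightarrow> greedy_end i a k \<le> greedy_end i a l"
  by (rule lift_Suc_mono_le[of "greedy_end i a"]) simp_all

text \<open>If a block ends no later in \<open>a\<close> than in \<open>b\<close>, its last entry is
  no larger, both by the earlier position in a sorted list and by the pointwise bound; so the next
  block is no longer either.\<close>

lemma greedy_end_pointwise_le:
  assumes "sorted a" "length b \<le> length a" "\<And>j. j < length b \<Longrightarrow> a ! j \<le> b ! j"
    and "greedy_end i b k < length b"
  shows "greedy_end i a k \<le> greedy_end i b k"
  using assms(4)
proof (induction k)
  case (Suc k)
  let ?x = "greedy_end i a k" and ?y = "greedy_end i b k"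
  have y: "?y < length b"
    using Suc.prems by (auto split: if_splits)
  have xy: "?x \<le> ?y" using Suc.IH y by simp
  have "a ! ?x \<le> a ! ?y"
    using assms(1,2) xy y by (simp add: sorted_nth_mono)
  also have "\<dots> \<le> b ! ?y" using assms(3) y by simp
  finally show ?case
    using xy y next_len_mono by (simp add: add_mono)
qed simp

lemma greedy_fits_if_subset:
  assumes "sorted a" "sorted b" "mset b \<subseteq># mset a" "greedy_end i b k < length b"
  shows "greedy_end i a k < length a"
proof -
  have "length b \<le> length a"
    using size_mset_mono[OF assms(3)] by simp
  with greedy_end_pointwise_le[OF assms(1) this sorted_subset_nth_le[OF assms(1-3)] assms(4)] assms(4)
  show ?thesis by simp
qed

text \<open>Puts \<open>xvar 1 ^ i\<close> on the same footing as the other generators: cut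
  greedily, \<open>i\<close> ones give blocks of length 1 up to block \<open>i\<close> and empty
  blocks afterwards.\<close>

lemma greedy_fits_replicate:
  assumes "1 \<le> i"
  shows "greedy_end i (replicate i 1) k < i"
proof -
  have "greedy_end i (replicate i 1) k \<le> min k (i - 1)"
    using assms by (induction k) (auto simp: next_len_def)
  with assms show ?thesis by linarith
qed

section \<open>The generators\<close>

lemma block_word_Suc:
  "block_word (Suc r) i n = block_word r i n @ map (n (Suc r)) [1..<block_len i n (Suc r) + 1]"
  by (simp add: block_word_def)

lemma prefix_block_word:
  assumes "k \<le> r"
  shows "\<exists>ys. block_word r i n = block_word k i n @ ys"
  using assms by (induction r rule: dec_induct) (auto simp: block_word_Suc)

text \<open>A generator is its own greedy cut. The delicate point is the empty block:
  \<open>block_len\<close> declares all later blocks empty, whereas \<open>greedy_end\<close> looks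
  at the same entry again.\<close>

lemma block_word_end:
  assumes "\<forall>a \<in> set (block_word r i n). 0 < a" "k < r"
  shows "Suc (greedy_end i (block_word r i n) k) = length (block_word (Suc k) i n) \<and>
    block_len i n (Suc (Suc k)) = next_len i k (block_word r i n ! greedy_end i (block_word r i n) k)"
  using assms(2)
proof (induction k)
  case 0
  obtain ys where "block_word r i n = n 1 1 # ys"
    using prefix_block_word[of 1 r i n] 0 by (auto simp: block_word_def)
  then show ?case by (simp add: block_word_def next_len_def)
next
  case (Suc k)
  let ?b = "block_word r i n"
  let ?f = "block_len i n (Suc (Suc k))"
  have IH: "Suc (greedy_end i ?b k) = length (block_word (Suc k) i n)"
    "?f = next_len i k (?b ! greedy_end i ?b k)"
    using Suc by simp_all
  obtain ys where ys: "?b = block_word (Suc (Suc k)) i n @ ys"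
    using prefix_block_word Suc.prems by (metis Suc_leI)
  have "greedy_end i ?b k < length ?b"
    using ys IH(1) by (simp add: block_word_Suc[of "Suc k"])
  then have step: "greedy_end i ?b (Suc k) = greedy_end i ?b k + ?f"
    unfolding IH(2) by simp
  then have end_eq: "Suc (greedy_end i ?b (Suc k)) = length (block_word (Suc (Suc k)) i n)"
    using IH(1) by (simp add: block_word_Suc[of "Suc k"] del: greedy_end.simps block_len.simps)
  have "block_len i n (Suc (Suc (Suc k))) = next_len i (Suc k) (?b ! greedy_end i ?b (Suc k))"
  proof (cases "?f = 0")
    case True
    have "?b ! greedy_end i ?b k > 0"
      using assms(1) \<open>greedy_end i ?b k < length ?b\<close> by simp
    \<comment> \<open>A positive entry yields an empty block only if it is 1 and block
      \<open>i\<close> is passed. The end does not move, so the same entry yields an empty block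
      once more.\<close>
    then have "\<not> k + 2 \<le> i" "?b ! greedy_end i ?b k = 1"
      using True unfolding IH(2) next_len_def by (auto split: if_splits)
    moreover have "block_len i n (Suc (Suc (Suc k))) = 0"
      using True by (subst block_len.simps) (simp add: Let_def del: block_len.simps)
    ultimately show ?thesis using True step by (simp add: next_len_def del: greedy_end.simps)
  next
    case False
    have "greedy_end i ?b (Suc k) = length (block_word (Suc k) i n) + (?f - 1)"
      using end_eq False IH(1) step by linarith
    moreover have "?b ! (length (block_word (Suc k) i n) + (?f - 1)) = n (Suc (Suc k)) ?f"
      using False unfolding ys block_word_Suc[of "Suc k"]
      by (cases ?f) (simp_all add: nth_append del: block_len.simps upt_Suc)
    ultimately have "?b ! greedy_end i ?b (Suc k) = n (Suc (Suc k)) ?f" by (simp only:)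
    then show ?thesis
      using False by (subst block_len.simps)
        (simp add: Let_def next_len_def del: greedy_end.simps block_len.simps)
  qed
  with end_eq show ?case by simp
qed

lemma greedy_fits_block_word:
  assumes "\<forall>a \<in> set (block_word r i n). 0 < a" "1 \<le> r"
  shows "greedy_end i (block_word r i n) (r - 1) < length (block_word r i n)"
  using block_word_end[OF assms(1), of "r - 1"] assms(2) by (simp del: greedy_end.simps)

lemma block_word_of_greedy:
  assumes "\<forall>x \<in> set a. 0 < x" "greedy_end i a (r - 1) < length a" "1 \<le> r"
  obtains n where "block_word r i n = take (Suc (greedy_end i a (r - 1))) a"
proof -
  \<comment> \<open>\<open>S j\<close> is the total length of the first \<open>j\<close> greedy
    blocks, so block \<open>j\<close> starts at position \<open>S (j - 1)\<close>; its entries are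
    counted from 1.\<close>
  define S where "S j = (case j of 0 \<Rightarrow> 0 | Suc k \<Rightarrow> Suc (greedy_end i a k))" for j
  define n where "n j k = a ! (S (j - 1) + k - 1)" for j k
  have S_mono: "S j \<le> S (Suc j)" for j
    by (simp add: S_def split: nat.split)
  have fits: "greedy_end i a k < length a" if "k < r" for k
    using greedy_end_mono[of k "r - 1" i a] that assms(2) by linarith
  have len: "block_len i n (Suc k) = S (Suc k) - S k" if "k < r" for k
    using that
  proof (induction k)
    case 0
    then show ?case by (simp add: S_def)
  next
    case (Suc k)
    let ?f = "block_len i n (Suc k)"
    have f: "?f = S (Suc k) - S k" and k: "k < r" using Suc by simp_all
    have R: "S (Suc (Suc k)) - S (Suc k) = next_len i k (a ! greedy_end i a k)"
      using fits[OF k] by (simp add: S_def)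
    show ?case
    proof (cases "?f = 0")
      case True
      \<comment> \<open>Block 1 has length 1, so an empty block has a predecessor. The end rests on
        a positive entry that already gave length 0, and it gives length 0 again for the next
        block.\<close>
      then obtain m where m: "k = Suc m" by (cases k) auto
      have eq: "greedy_end i a k = greedy_end i a m"
        using True f S_mono[of k] by (simp add: S_def m)
      then have "next_len i m (a ! greedy_end i a m) = 0"
        using fits[of m] k by (simp add: m)
      moreover have "0 < a ! greedy_end i a m"
        using assms(1) fits[of m] k by (simp add: m)
      ultimately have "next_len i k (a ! greedy_end i a k) = 0"
        unfolding eq by (auto simp: next_len_def m split: if_splits)
      with R True show ?thesis by simp
    next
      case False
      then have "n (Suc k) ?f = a ! greedy_end i a k"
        using f S_mono[of k] by (simp add: n_def S_def)
      with R False show ?thesis by (simp add: next_len_def Let_def)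
    qed
  qed
  have "block_word k i n = take (S k) a" if "k \<le> r" for k
    using that
  proof (induction k)
    case 0
    then show ?case by (simp add: block_word_def S_def)
  next
    case (Suc k)
    have "S (Suc k) \<le> length a" using fits[of k] Suc.prems by (simp add: S_def)
    then have "map (n (Suc k)) [1..<block_len i n (Suc k) + 1] = take (S (Suc k) - S k) (drop (S k) a)"
      using Suc.prems S_mono[of k] by (intro nth_equalityI) (auto simp: len n_def simp del: upt_Suc)
    then have "block_word (Suc k) i n = take (S k) a @ take (S (Suc k) - S k) (drop (S k) a)"
      using Suc by (simp only: block_word_Suc)
    also have "\<dots> = take (S (Suc k)) a"
      using S_mono[of k] by (metis le_add_diff_inverse take_add)
    finally show ?case .
  qed
  from this[of r] assms(3) show thesis
    by (intro that[of n]) (auto simp: S_def split: nat.split)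
qed

text \<open>The greedy blocks fit into every generator, hence into \<open>\<mu>\<close> once a
  generator divides its monomial; conversely, blocks that fit spell out a generator.\<close>

lemma xmonom_mem_I_ideal_iff:
  assumes "1 \<le> i" "1 \<le> r" "is_partition \<mu>"
  shows "(xmonom \<mu> :: 'k::comm_ring_1 xpoly) \<in> I_ideal r i \<longleftrightarrow>
    greedy_end i (rev \<mu>) (r - 1) < length \<mu>"
proof -
  let ?W = "{block_word r i n | n. sorted (block_word r i n) \<and> (\<forall>a \<in> set (block_word r i n). 0 < a)}"
  let ?J = "insert (replicate i 1) ?W"
  have srt: "sorted (rev \<mu>)" and pos: "\<forall>a \<in> set \<mu>. 0 < a"
    using assms(3) by (auto simp: is_partition_def sorted_wrt_rev)
  have J_pos: "\<forall>a \<in> set js. 0 < a" if "js \<in> ?J" for js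
    using that by auto
  have "(xmonom ` ?J :: 'k xpoly set) = insert (xvar 1 ^ i)
       {xmonom (block_word r i n) | n.
          sorted (block_word r i n) \<and> (\<forall>a \<in> set (block_word r i n). 0 < a)}"
    by (auto simp: xmonom_def map_replicate prod_list_replicate)
  then have "(I_ideal r i :: 'k xpoly set) = ideal_gen (xmonom ` ?J)"
    by (simp add: I_ideal_def)
  then have "(xmonom \<mu> :: 'k xpoly) \<in> I_ideal r i \<longleftrightarrow> (\<exists>js \<in> ?J. mset js \<subseteq># mset (rev \<mu>))"
    using xmonom_mem_ideal_iff[OF pos J_pos, where 'k = 'k] by (simp only: mset_rev)
  also have "\<dots> \<longleftrightarrow> greedy_end i (rev \<mu>) (r - 1) < length (rev \<mu>)" (is "?L \<longleftrightarrow> ?R")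
  proof
    assume ?L
    then obtain js where js: "js \<in> ?J" "mset js \<subseteq># mset (rev \<mu>)" by blast
    have "sorted js \<and> greedy_end i js (r - 1) < length js"
      using js(1) greedy_fits_replicate[OF assms(1)] greedy_fits_block_word[OF _ assms(2)] by auto
    then show ?R using greedy_fits_if_subset[OF srt _ js(2)] by blast
  next
    assume ?R
    then obtain n where n: "block_word r i n = take (Suc (greedy_end i (rev \<mu>) (r - 1))) (rev \<mu>)"
      using block_word_of_greedy[of "rev \<mu>"] pos assms(2) by auto
    have "sorted (block_word r i n)" unfolding n by (rule sorted_wrt_take[OF srt])
    moreover have "\<forall>a \<in> set (block_word r i n). 0 < a"
      unfolding n using pos by (auto dest!: in_set_takeD)
    moreover have "mset (block_word r i n) \<subseteq># mset (rev \<mu>)"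
      unfolding n by (metis append_take_drop_id mset_append mset_subset_eq_add_left)
    ultimately show ?L by blast
  qed
  finally show ?thesis by simp
qed

section \<open>The set \<open>C_set\<close>\<close>

text \<open>Simultaneous induction, as each value depends on the preceding sum. The
  \<open>max\<close> term counts the blocks past block \<open>i\<close> among blocks 2 to
  \<open>k + 1\<close>, each one shorter than the value that prescribes it. The side condition
  excludes the stuck regime, where the end is fixed but this correction may still grow.\<close>

lemma p_seq_greedy:
  assumes "1 \<le> i" "is_partition \<mu>"
  shows "p_seq i \<mu> (Suc k) = (if greedy_end i (rev \<mu>) k < length \<mu> then rev \<mu> ! greedy_end i (rev \<mu>) k else 0)"
    and "(k = 0 \<or> greedy_end i (rev \<mu>) (k - 1) < length \<mu>) \<Longrightarrow>
      int (greedy_end i (rev \<mu>) k) = (\<Sum>j = 1..<Suc k. int (p_seq i \<mu> j)) - max 0 (int k + 1 - int i)"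
proof (induction k)
  case 0
  {
    case 1
    show ?case
      by (cases "\<mu> = []")
        (auto simp: p_seq.simps Defs.part_def rev_nth nat_diff_distrib Suc_le_eq)
  next
    case 2
    show ?case using assms(1) by simp
  }
next
  case (Suc k)
  let ?e = "greedy_end i (rev \<mu>)"
  have pos: "0 < rev \<mu> ! x" if "x < length \<mu>" for x
    using assms(2) that nth_mem[of x "rev \<mu>"] by (simp add: is_partition_def)
  have sum: "int (?e (Suc k)) = (\<Sum>j = 1..<Suc (Suc k). int (p_seq i \<mu> j)) - max 0 (int (Suc k) + 1 - int i)"
    if fit: "?e k < length \<mu>"
  proof -
    have "?e (k - 1) < length \<mu>"
      using fit greedy_end_mono[of "k - 1" k i "rev \<mu>"] by linarith
    then have "int (?e k) = (\<Sum>j = 1..<Suc k. int (p_seq i \<mu> j)) - max 0 (int k + 1 - int i)"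
      using Suc.IH(2) by blast
    moreover have "int (?e (Suc k)) = int (?e k) + int (p_seq i \<mu> (Suc k)) - (if k + 2 \<le> i then 0 else 1)"
      using fit pos[OF fit] by (simp add: Suc.IH(1) next_len_def)
    ultimately show ?thesis by (simp del: greedy_end.simps)
  qed
  {
    case 1
    show ?case
    proof (cases "?e k < length \<mu>")
      case False
      then have "p_seq i \<mu> (Suc k) = 0" by (simp add: Suc.IH(1))
      then have "p_seq i \<mu> (Suc (Suc k)) = 0" by (subst p_seq.simps) simp
      with False show ?thesis by simp
    next
      case True
      have max_eq: "max 0 (int (Suc k) + 1 - int i)
          = (if Suc (Suc k) \<le> i then 0 else int (Suc (Suc k)) - int i)"
        by auto
      have "p_seq i \<mu> (Suc k) \<noteq> 0" using True pos[OF True] by (simp add: Suc.IH(1))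
      \<comment> \<open>Position e counted from the smallest part is part number
        \<open>length \<mu>\<close> - e; a non-positive number, where \<open>part\<close> is 0 by
        convention, means that the cut is stuck.\<close>
      then have "p_seq i \<mu> (Suc (Suc k)) = part \<mu> (int (length \<mu>) - int (?e (Suc k)))"
        unfolding sum[OF True] max_eq
        by (subst p_seq.simps) (auto simp: algebra_simps)
      then show ?thesis
        by (auto simp: Defs.part_def rev_nth nat_diff_distrib simp del: greedy_end.simps
          intro!: arg_cong[where f = "(!) \<mu>"])
    qed
  next
    case 2
    then show ?case using sum by simp
  }
qed

text \<open>\<open>N_num r i \<mu> = r - 1\<close> says that the first \<open>r - 1\<close> blocks
  fit, and the inequality on the sum then says that block \<open>r\<close> does not; a smaller value
  says that the blocks fail earlier.\<close>

lemma mem_C_set_iff: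
  assumes "2 \<le> r" "1 \<le> i" "i \<le> r" "is_partition \<mu>"
  shows "\<mu> \<in> C_set r i \<longleftrightarrow> \<not> greedy_end i (rev \<mu>) (r - 1) < length \<mu>"
proof -
  let ?e = "greedy_end i (rev \<mu>)" and ?A = "{l \<in> {1..r - 1}. p_seq i \<mu> l \<noteq> 0}"
  have srt: "sorted (rev \<mu>)"
    using assms(4) by (simp add: is_partition_def sorted_wrt_rev)
  have pos: "0 < rev \<mu> ! x" if "x < length \<mu>" for x
    using assms(4) that nth_mem[of x "rev \<mu>"] by (simp add: is_partition_def)
  have r: "Suc (r - 2) = r - 1" using assms(1) by simp
  have nz: "p_seq i \<mu> (Suc k) \<noteq> 0 \<longleftrightarrow> ?e k < length \<mu>" for k
    using pos by (auto simp: p_seq_greedy(1)[OF assms(2,4)])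
  have N: "N_num r i \<mu> = r - 1 \<longleftrightarrow> ?e (r - 2) < length \<mu>"
  proof
    assume "N_num r i \<mu> = r - 1"
    then have "?A = {1..r - 1}"
      by (intro card_subset_eq) (auto simp: N_num_def)
    moreover have "r - 1 \<in> {1..r - 1}" using assms(1) by simp
    ultimately have "p_seq i \<mu> (Suc (r - 2)) \<noteq> 0" unfolding r by blast
    then show "?e (r - 2) < length \<mu>" using nz by blast
  next
    assume e: "?e (r - 2) < length \<mu>"
    have "p_seq i \<mu> l \<noteq> 0" if "l \<in> {1..r - 1}" for l
    proof -
      have "?e (l - 1) < length \<mu>"
        using e greedy_end_mono[of "l - 1" "r - 2" i "rev \<mu>"] that by fastforce
      then show ?thesis using nz[of "l - 1"] that by simp
    qed
    then have "?A = {1..r - 1}" by blast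
    then show "N_num r i \<mu> = r - 1" by (simp add: N_num_def)
  qed
  have "N_num r i \<mu> \<le> card {1..r - 1}"
    unfolding N_num_def by (intro card_mono) auto
  then have N_le: "N_num r i \<mu> \<le> r - 1" by simp
  \<comment> \<open>Given \<open>i\<close> parts equal to 1, the blocks would fit into these ones
    and hence into \<open>\<mu>\<close>.\<close>
  have ones: "count_list \<mu> 1 \<le> i - 1" if "\<not> ?e (r - 1) < length \<mu>"
  proof (rule ccontr)
    assume "\<not> count_list \<mu> 1 \<le> i - 1"
    then have "i \<le> count (mset (rev \<mu>)) 1" by (simp add: count_mset)
    then have "mset (replicate i 1) \<subseteq># mset (rev \<mu>)"
      by (auto simp: subseteq_mset_def)
    then have "?e (r - 1) < length (rev \<mu>)"
      using greedy_fits_if_subset[OF srt, of "replicate i 1"] greedy_fits_replicate[OF assms(2)] by simp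
    with that show False by simp
  qed
  show ?thesis
  proof (cases "?e (r - 2) < length \<mu>")
    case True
    then have "int (?e (r - 1)) = (\<Sum>j = 1..<Suc (r - 1). int (p_seq i \<mu> j)) - max 0 (int (r - 1) + 1 - int i)"
      using assms(1) by (intro p_seq_greedy(2)[OF assms(2,4)]) (simp add: numeral_2_eq_2)
    also have "{1..<Suc (r - 1)} = {1..r - 1}" by auto
    also have "max 0 (int (r - 1) + 1 - int i) = int r - int i" using assms by simp
    finally show ?thesis
      using True N ones assms(4) unfolding C_set_def by auto
  next
    case False
    then have "\<not> ?e (r - 1) < length \<mu>"
      using greedy_end_mono[of "r - 2" "r - 1" i "rev \<mu>"] by linarith
    with False N N_le ones assms(4) show ?thesis unfolding C_set_def by auto
  qed
qed

section \<open>Durfee dissections\<close>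

lemma part_of_nat: "0 < d \<Longrightarrow> d \<le> length \<nu> \<Longrightarrow> part \<nu> (int d) = \<nu> ! (d - 1)"
  by (simp add: Defs.part_def nat_diff_distrib)

lemma sq_bounds:
  shows "sq \<nu> \<le> length \<nu>"
    and "0 < sq \<nu> \<Longrightarrow> sq \<nu> \<le> \<nu> ! (sq \<nu> - 1)"
    and "sq \<nu> < length \<nu> \<Longrightarrow> \<nu> ! sq \<nu> \<le> sq \<nu>"
proof -
  let ?S = "{d. d \<le> length \<nu> \<and> (d = 0 \<or> d \<le> part \<nu> (int d))}"
  have fin: "finite ?S" by simp
  have mem: "sq \<nu> \<in> ?S" unfolding sq_def by (intro Max_in fin) auto
  have max: "d \<le> sq \<nu>" if "d \<in> ?S" for d unfolding sq_def using that by (intro Max_ge fin)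
  show "sq \<nu> \<le> length \<nu>" using mem by simp
  show "sq \<nu> \<le> \<nu> ! (sq \<nu> - 1)" if "0 < sq \<nu>"
    using mem that part_of_nat[of "sq \<nu>" \<nu>] by auto
  show "\<nu> ! sq \<nu> \<le> sq \<nu>" if "sq \<nu> < length \<nu>"
    by (rule ccontr) (use max[of "Suc (sq \<nu>)"] that part_of_nat[of "Suc (sq \<nu>)" \<nu>] in auto)
qed

text \<open>The excess width 1 of the rectangle is moved to the side of the part, to match
  \<open>next_len\<close> past block \<open>i\<close>.\<close>

lemma rect_bounds:
  shows "rect \<nu> \<le> length \<nu>"
    and "0 < rect \<nu> \<Longrightarrow> rect \<nu> \<le> \<nu> ! (rect \<nu> - 1) - 1"
    and "rect \<nu> < length \<nu> \<Longrightarrow> \<nu> ! rect \<nu> - 1 \<le> rect \<nu>"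
proof -
  let ?S = "{d. d \<le> length \<nu> \<and> (d = 0 \<or> d + 1 \<le> part \<nu> (int d))}"
  have fin: "finite ?S" by simp
  have mem: "rect \<nu> \<in> ?S" unfolding rect_def by (intro Max_in fin) auto
  have max: "d \<le> rect \<nu>" if "d \<in> ?S" for d unfolding rect_def using that by (intro Max_ge fin)
  show "rect \<nu> \<le> length \<nu>" using mem by simp
  show "rect \<nu> \<le> \<nu> ! (rect \<nu> - 1) - 1" if "0 < rect \<nu>"
    using mem that part_of_nat[of "rect \<nu>" \<nu>] by auto
  show "\<nu> ! rect \<nu> - 1 \<le> rect \<nu>" if "rect \<nu> < length \<nu>"
    using max[of "Suc (rect \<nu>)"] that part_of_nat[of "Suc (rect \<nu>)" \<nu>]
    by (cases "Suc (Suc (rect \<nu>)) \<le> \<nu> ! rect \<nu>") auto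
qed

text \<open>Positions \<open>x\<close> count from the smallest part. An entry below the top
  \<open>c\<close> parts gives a block of length at most \<open>c\<close>, which still ends inside
  \<open>\<nu>\<close>; an entry among the top \<open>c\<close> parts gives length at least
  \<open>c\<close>, which overshoots.\<close>

lemma durfee_step:
  assumes srt: "sorted_wrt (\<ge>) \<nu>" and x: "x < length \<nu>"
    and c: "c \<le> length \<nu>" "0 < c \<Longrightarrow> c \<le> next_len i k (\<nu> ! (c - 1))"
      "c < length \<nu> \<Longrightarrow> next_len i k (\<nu> ! c) \<le> c"
  shows "x + next_len i k (rev \<nu> ! x) < length \<nu> \<longleftrightarrow> x < length \<nu> - c"
proof -
  let ?y = "length \<nu> - Suc x"
  have rev: "rev \<nu> ! x = \<nu> ! ?y" using x by (simp add: rev_nth)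
  have anti: "\<nu> ! q \<le> \<nu> ! p" if "p \<le> q" "q < length \<nu>" for p q
    using srt that by (cases "p = q") (auto simp: sorted_wrt_iff_nth_less)
  show ?thesis
  proof (cases "x < length \<nu> - c")
    case True
    then have "next_len i k (\<nu> ! ?y) \<le> next_len i k (\<nu> ! c)"
      using x by (intro next_len_mono anti) auto
    also have "\<dots> \<le> c" using True c(3) by simp
    finally show ?thesis using True by (simp add: rev)
  next
    case False
    then have c0: "0 < c" using x by simp
    have "c \<le> next_len i k (\<nu> ! (c - 1))" using c(2) c0 by simp
    also have "\<dots> \<le> next_len i k (\<nu> ! ?y)"
      using False x c(1) c0 by (intro next_len_mono anti) auto
    finally show ?thesis using False by (simp add: rev)
  qed
qed

text \<open>Only largest parts are removed, so the reversal of what remains is an initial segment of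
  \<open>rev \<mu>\<close> and greedy positions keep their meaning.\<close>

lemma dissect_suffix: "\<exists>m. dissect r i \<mu> j = drop m \<mu>"
proof (induction j)
  case 0
  show ?case by (intro exI[of _ 0]) simp
next
  case (Suc j)
  then show ?case by (auto simp: Let_def)
qed

lemma dissect_greedy_step:
  assumes "is_partition \<mu>" "i \<le> r" "j + k + 2 = r"
  shows "greedy_end i (rev \<mu>) (Suc k) < length (dissect r i \<mu> j) \<longleftrightarrow>
    greedy_end i (rev \<mu>) k < length (dissect r i \<mu> (Suc j))"
proof -
  define \<nu> where "\<nu> = dissect r i \<mu> j"
  define c where "c = (if Suc j \<le> r - i then rect \<nu> else sq \<nu>)"
  let ?x = "greedy_end i (rev \<mu>) k"
  obtain m where m: "\<nu> = drop m \<mu>" using dissect_suffix[of r i \<mu> j] by (auto simp: \<nu>_def)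
  have srt: "sorted_wrt (\<ge>) \<nu>"
    using assms(1) by (simp add: m is_partition_def sorted_wrt_drop)
  have len: "length (dissect r i \<mu> (Suc j)) = length \<nu> - c"
    by (simp add: \<nu>_def c_def Let_def)
  \<comment> \<open>Dissection step \<open>j + 1\<close> is paired with block \<open>k + 2\<close>,
    in opposite orders: the rectangles, taken first, meet exactly the blocks past block
    \<open>i\<close>.\<close>
  have side: "Suc j \<le> r - i \<longleftrightarrow> \<not> k + 2 \<le> i" using assms(2,3) by auto
  have c: "c \<le> length \<nu>" "0 < c \<Longrightarrow> c \<le> next_len i k (\<nu> ! (c - 1))"
      "c < length \<nu> \<Longrightarrow> next_len i k (\<nu> ! c) \<le> c"
    using sq_bounds[of \<nu>] rect_bounds[of \<nu>] unfolding c_def next_len_def side by auto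
  show ?thesis
  proof (cases "?x < length \<nu>")
    case True
    then have "?x < length \<mu>" "rev \<mu> ! ?x = rev \<nu> ! ?x"
      by (simp_all add: m rev_drop)
    then show ?thesis
      using durfee_step[OF srt True c] unfolding len by (simp add: \<nu>_def)
  next
    case False
    then show ?thesis unfolding len by (simp add: \<nu>_def)
  qed
qed

lemma mem_D_set_iff:
  assumes "1 \<le> r" "i \<le> r" "is_partition \<mu>"
  shows "\<mu> \<in> D_set r i \<longleftrightarrow> \<not> greedy_end i (rev \<mu>) (r - 1) < length \<mu>"
proof -
  have "greedy_end i (rev \<mu>) (r - 1) < length \<mu> \<longleftrightarrow>
    greedy_end i (rev \<mu>) (r - 1 - j) < length (dissect r i \<mu> j)" if "j \<le> r - 1" for j
    using that
  proof (induction j)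
    case (Suc j)
    then have "r - 1 - j = Suc (r - 1 - Suc j)" "j + (r - 1 - Suc j) + 2 = r" by simp_all
    with Suc dissect_greedy_step[OF assms(3,2), of j "r - 1 - Suc j"] show ?case
      by (metis Suc_leD)
  qed simp
  \<comment> \<open>At \<open>j = r - 1\<close> the end is
    \<open>greedy_end i (rev \<mu>) 0 = 0\<close>, so the right-hand side says that the last
    remainder is nonempty.\<close>
  from this[of "r - 1"] assms(3) show ?thesis by (simp add: D_set_def)
qed

theorem theorem4p1:
  fixes r i :: nat
  assumes "2 \<le> r" and "1 \<le> i" and "i \<le> r"
  shows "(\<forall>\<mu>. is_partition \<mu> \<longrightarrow>
            ((xmonom \<mu> :: 'k::field_char_0 xpoly) \<notin> I_ideal r i \<longleftrightarrow> \<mu> \<in> D_set r i))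
         \<and> C_set r i = D_set r i"
proof
  have r: "1 \<le> r" using assms(1) by simp
  show "\<forall>\<mu>. is_partition \<mu> \<longrightarrow>
      ((xmonom \<mu> :: 'k xpoly) \<notin> I_ideal r i \<longleftrightarrow> \<mu> \<in> D_set r i)"
    using xmonom_mem_I_ideal_iff[OF assms(2) r] mem_D_set_iff[OF r assms(3)] by blast
  have "\<mu> \<in> C_set r i \<longleftrightarrow> \<mu> \<in> D_set r i" for \<mu>
  proof (cases "is_partition \<mu>")
    case True
    then show ?thesis
      using mem_C_set_iff[OF assms] mem_D_set_iff[OF r assms(3)] by blast
  next
    case False
    then show ?thesis by (simp add: C_set_def D_set_def)
  qed
  then show "C_set r i = D_set r i" by blast
qed

end
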